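(* Associativity of composition, and even weak associativity, can fail in the completion $\Gamma_D[\mathcal A]$ of an ordered domain algebra $\mathcal A$: if $\mathcal A$ is the full proper ordered domain algebra over a base of five elements, then there are $A,B,C\in\Gamma_D[\mathcal A]$ with $A\leq\mathbf{id}_\gamma$ such that $(A;_\gamma B);_\gamma C\neq A;_\gamma(B;_\gamma C)$.
   Context: The full proper ordered domain algebra over a base set $U$ has as elements all binary relations on $U$, ordered by $\subseteq$, with $x;y=\{(u,v):\exists w\,(u,w)\in x,(w,v)\in y\}$, $\mathbf{dom}(x)=\{(u,u):\exists v\,(u,v)\in x\}$, $\mathbf{ran}(x)=\{(v,v):\exists u\,(u,v)\in x\}$, $x^\smile=\{(v,u):(u,v)\in x\}$, $0=\emptyset$, $\mathbf{id}=\{(u,u):u\in U\}$. It is an ordered domain algebra. For an ordered domain algebra $\mathcal A$ with underlying poset $(P,\leq)$ and $S\subseteq P$ put $S^\uparrow=\{p\in P:\exists s\in S,\ s\leq p\}$. An up-set $X$ of $P$ ($\emptyset$ allowed) is $\Gamma_D$-closed if $\{\mathbf{dom}(x);y;\mathbf{ran}(z):x,y,z\in X\}^\uparrow=X$, and $\Gamma_D(X)$ is the smallest $\Gamma_D$-closed up-set containing the up-set $X$. $\Gamma_D[\mathcal A]$ is the set of $\Gamma_D$-closed up-sets ordered by reverse inclusion ($C\leq D\iff C\supseteq D$), with $C;_\gamma D=\Gamma_D(\{c;d:c\in C,d\in D\}^\uparrow)$ and $\mathbf{id}_\gamma=\{\mathbf{id}\}^\uparrow$. The weak associativity law meant here is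 associativity $(A;_\gamma B);_\gamma C=A;_\gamma(B;_\gamma C)$ required only for $A\leq\mathbf{id}_\gamma$. *)

theory Defs
  imports Main "HOL.Hull"
begin

record 'a oda =
  carr :: "'a set"
  le   :: "'a \<Rightarrow> 'a \<Rightarrow> bool"
  cmp  :: "'a \<Rightarrow> 'a \<Rightarrow> 'a"
  dm   :: "'a \<Rightarrow> 'a"
  rn   :: "'a \<Rightarrow> 'a"
  cnv  :: "'a \<Rightarrow> 'a"
  zro  :: "'a"
  idn  :: "'a"

definition full_proper :: "'u set \<Rightarrow> 'u rel oda" where
  "full_proper U =
     \<lparr> carr = Pow (U \<times> U),
       le = (\<subseteq>),
       cmp = (O),
       dm = (\<lambda>x. {(u, u) | u. \<exists>v. (u, v) \<in> x}),
       rn = (\<lambda>x. {(v, v) | v. \<exists>u. (u, v) \<in> x}),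
       cnv = converse,
       zro = {},
       idn = Id_on U \<rparr>"

definition up :: "('a, 'm) oda_scheme \<Rightarrow> 'a set \<Rightarrow> 'a set" where
  "up \<A> S = {p \<in> carr \<A>. \<exists>s\<in>S. le \<A> s p}"

definition up_set :: "('a, 'm) oda_scheme \<Rightarrow> 'a set \<Rightarrow> bool" where
  "up_set \<A> X \<longleftrightarrow>
     X \<subseteq> carr \<A> \<and> (\<forall>x\<in>X. \<forall>p\<in>carr \<A>. le \<A> x p \<longrightarrow> p \<in> X)"

definition GammaD_closed :: "('a, 'm) oda_scheme \<Rightarrow> 'a set \<Rightarrow> bool" where
  "GammaD_closed \<A> X \<longleftrightarrow>
     up_set \<A> X \<and>
     up \<A> {cmp \<A> (cmp \<A> (dm \<A> x) y) (rn \<A> z) | x y z. x \<in> X \<and> y \<in> X \<and> z \<in> X} = X"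

text \<open>
  The operator \<open>hull\<close> yields the intersection of all closed supersets. In an ordered domain
  algebra \<open>y = dom(y);y;ran(y)\<close>, so closed up-sets are stable under intersection and this is
  the smallest one; for the full algebra this is verified below.
\<close>

definition GammaD :: "('a, 'm) oda_scheme \<Rightarrow> 'a set \<Rightarrow> 'a set" where
  "GammaD \<A> X = GammaD_closed \<A> hull X"

definition completion :: "('a, 'm) oda_scheme \<Rightarrow> 'a set set" where
  "completion \<A> = {X. GammaD_closed \<A> X}"

definition le_gamma :: "'a set \<Rightarrow> 'a set \<Rightarrow> bool" where
  "le_gamma C D \<longleftrightarrow> D \<subseteq> C"

definition cmp_gamma :: "('a, 'm) oda_scheme \<Rightarrow> 'a set \<Rightarrow> 'a set \<Rightarrow> 'a set" where
  "cmp_gamma \<A> C D = GammaD \<A> (up \<A> {cmp \<A> c d | c d. c \<in> C \<and> d \<in> D})"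

definition id_gamma :: "('a, 'm) oda_scheme \<Rightarrow> 'a set" where
  "id_gamma \<A> = up \<A> {idn \<A>}"

lemma full_proper_closed_iff:
  "GammaD_closed (full_proper U) X \<longleftrightarrow>
     up_set (full_proper U) X \<and>
     (\<forall>x\<in>X. \<forall>y\<in>X. \<forall>z\<in>X. Id_on (Domain x) O y O Id_on (Range z) \<in> X)"
  (is "?L \<longleftrightarrow> ?R")
proof -
  have d: "dm (full_proper U) x = Id_on (Domain x)"
    and r: "rn (full_proper U) x = Id_on (Range x)" for x
    by (auto simp: full_proper_def)
  have c: "cmp (full_proper U) = (O)" and l: "le (full_proper U) = (\<subseteq>)"
    and k: "carr (full_proper U) = Pow (U \<times> U)"
    by (simp_all add: full_proper_def)
  show ?thesis
  proof
    assume L: ?L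
    then have us: "up_set (full_proper U) X"
      and eq: "up (full_proper U)
        {(Id_on (Domain x) O y) O Id_on (Range z) | x y z. x \<in> X \<and> y \<in> X \<and> z \<in> X} = X"
      unfolding GammaD_closed_def d r c by blast+
    have "Id_on (Domain x) O y O Id_on (Range z) \<in> X"
      if "x \<in> X" "y \<in> X" "z \<in> X" for x y z
    proof -
      have "y \<subseteq> U \<times> U" using us that by (auto simp: up_set_def k)
      then have "Id_on (Domain x) O y O Id_on (Range z) \<in> Pow (U \<times> U)" by auto
      then have "Id_on (Domain x) O y O Id_on (Range z) \<in> up (full_proper U)
        {(Id_on (Domain x) O y) O Id_on (Range z) | x y z. x \<in> X \<and> y \<in> X \<and> z \<in> X}"
        using that by (subst up_def) (auto simp only: k l O_assoc mem_Collect_eq)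
      then show ?thesis using eq by simp
    qed
    with us show ?R by blast
  next
    assume R: ?R
    have "up (full_proper U)
        {(Id_on (Domain x) O y) O Id_on (Range z) | x y z. x \<in> X \<and> y \<in> X \<and> z \<in> X} = X"
      (is "up _ ?S = X")
    proof
      show "up (full_proper U) ?S \<subseteq> X"
      proof
        fix p assume "p \<in> up (full_proper U) ?S"
        then obtain x y z where p: "p \<in> carr (full_proper U)" "x \<in> X" "y \<in> X" "z \<in> X"
          "le (full_proper U) ((Id_on (Domain x) O y) O Id_on (Range z)) p"
          unfolding up_def by blast
        from R p(2-4) have "(Id_on (Domain x) O y) O Id_on (Range z) \<in> X"
          by (simp only: O_assoc)
        with R p(1,5) show "p \<in> X" unfolding up_set_def by blast
      qed
      show "X \<subseteq> up (full_proper U) ?S"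
      proof
        fix y assume y: "y \<in> X"
        have "y = (Id_on (Domain y) O y) O Id_on (Range y)"
          by auto
        with y have "y \<in> ?S" by (intro CollectI exI conjI)
        moreover have "y \<in> carr (full_proper U)" using R y by (auto simp: up_set_def)
        moreover have "le (full_proper U) y y" by (simp add: l)
        ultimately show "y \<in> up (full_proper U) ?S" unfolding up_def by blast
      qed
    qed
    with R show ?L unfolding GammaD_closed_def d r c by blast
  qed
qed

lemma full_proper_GammaD_least:
  assumes "up_set (full_proper U) X"
  shows "GammaD_closed (full_proper U) (GammaD (full_proper U) X)"
    and "X \<subseteq> GammaD (full_proper U) X"
    and "\<And>Y. GammaD_closed (full_proper U) Y \<Longrightarrow> X \<subseteq> Y \<Longrightarrow> GammaD (full_proper U) X \<subseteq> Y"
proof -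
  have top: "GammaD_closed (full_proper U) (Pow (U \<times> U))"
    unfolding full_proper_closed_iff by (fastforce simp: up_set_def full_proper_def)
  have X: "X \<subseteq> Pow (U \<times> U)"
    using assms by (auto simp: up_set_def full_proper_def)
  let ?F = "{Y. GammaD_closed (full_proper U) Y \<and> X \<subseteq> Y}"
  have ne: "Pow (U \<times> U) \<in> ?F" using top X by simp
  have "up_set (full_proper U) (\<Inter>?F)"
    unfolding up_set_def
  proof (intro conjI ballI impI)
    have "\<Inter>?F \<subseteq> Pow (U \<times> U)" using ne by (rule Inter_lower)
    then show "\<Inter>?F \<subseteq> carr (full_proper U)" by (simp add: full_proper_def)
    fix x p assume "x \<in> \<Inter>?F" "p \<in> carr (full_proper U)" "le (full_proper U) x p"
    show "p \<in> \<Inter>?F"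
    proof (rule InterI)
      fix Y assume Y: "Y \<in> ?F"
      then have "up_set (full_proper U) Y" by (simp add: full_proper_closed_iff)
      moreover have "x \<in> Y" using \<open>x \<in> \<Inter>?F\<close> Y by (rule InterD)
      ultimately show "p \<in> Y"
        using \<open>p \<in> carr (full_proper U)\<close> \<open>le (full_proper U) x p\<close> unfolding up_set_def by blast
    qed
  qed
  moreover have "\<forall>x\<in>\<Inter>?F. \<forall>y\<in>\<Inter>?F. \<forall>z\<in>\<Inter>?F. Id_on (Domain x) O y O Id_on (Range z) \<in> \<Inter>?F"
  proof (intro ballI InterI)
    fix x y z Y assume *: "x \<in> \<Inter>?F" "y \<in> \<Inter>?F" "z \<in> \<Inter>?F" and Y: "Y \<in> ?F"
    have "x \<in> Y" "y \<in> Y" "z \<in> Y" using *[THEN InterD, OF Y] by simp_all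
    with Y show "Id_on (Domain x) O y O Id_on (Range z) \<in> Y"
      by (simp add: full_proper_closed_iff)
  qed
  ultimately have "GammaD_closed (full_proper U) (\<Inter>?F)"
    by (rule iffD2[OF full_proper_closed_iff, OF conjI])
  then show "GammaD_closed (full_proper U) (GammaD (full_proper U) X)"
    by (simp add: GammaD_def hull_def)
  show "X \<subseteq> GammaD (full_proper U) X"
    by (simp add: GammaD_def hull_subset)
  show "\<And>Y. GammaD_closed (full_proper U) Y \<Longrightarrow> X \<subseteq> Y \<Longrightarrow> GammaD (full_proper U) X \<subseteq> Y"
    by (simp add: GammaD_def hull_minimal)
qed

end

theory Submission
  imports Defs
begin

text \<open>
  The closure \<open>\<Gamma>\<^sub>D\<close> forces the minimal members of an up-set of relations to share one domain and
  one range, since each member may be restricted to the domains and ranges of the others. If the generators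
  already have one common domain and one common range, the up-set that they generate is closed
  (\<open>GammaD_closed_up_uniform\<close>).

  Let \<open>a, b, c, d, e\<close> be the five points and put
  \<open>A = {{(a,a)}}\<^sup>\<up>\<close>,
  \<open>B = {{(a,c),(b,d)}, {(a,d),(b,c)}}\<^sup>\<up>\<close> and
  \<open>C = {{(c,e),(d,e)}}\<^sup>\<up>\<close>. The two generators of \<open>B\<close> have the same domain \<open>{a,b}\<close> and the same
  range \<open>{c,d}\<close>, but restricting them to \<open>a\<close> leaves \<open>{(a,c)}\<close> and \<open>{(a,d)}\<close>, whose ranges are
  disjoint. So the closure in \<open>A ;\<^sub>\<gamma> B\<close> produces the empty relation, which then survives
  composition with \<open>C\<close>. In the other bracketing \<open>C\<close> is applied first and merges \<open>c\<close> and \<open>d\<close>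
  into \<open>e\<close>, so no conflict between ranges arises: every relation in \<open>B ;\<^sub>\<gamma> C\<close>, and hence in
  \<open>A ;\<^sub>\<gamma> (B ;\<^sub>\<gamma> C)\<close>, contains \<open>(a,e)\<close>, and the empty relation is absent.
\<close>

lemma mem_up_full_proper:
  "p \<in> up (full_proper U) S \<longleftrightarrow> p \<subseteq> U \<times> U \<and> (\<exists>s\<in>S. s \<subseteq> p)"
  by (simp add: up_def full_proper_def)

lemma up_set_up_full_proper: "up_set (full_proper U) (up (full_proper U) S)"
  unfolding up_set_def up_def full_proper_def by (simp add: subset_iff) meson

text \<open>
  Every member of the up-set has domain at least \<open>D\<close> and range at least \<open>R\<close>, so restricting a
  member to the domain and range of others does not touch the generator below it.
\<close>

lemma GammaD_closed_up_uniform: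
  assumes "\<And>q. q \<in> Q \<Longrightarrow> Domain q = D" and "\<And>q. q \<in> Q \<Longrightarrow> Range q = R"
  shows "GammaD_closed (full_proper U) (up (full_proper U) Q)"
  unfolding full_proper_closed_iff
proof (intro conjI ballI up_set_up_full_proper)
  fix x y z
  assume x: "x \<in> up (full_proper U) Q" and y: "y \<in> up (full_proper U) Q"
    and z: "z \<in> up (full_proper U) Q"
  from y obtain q where q: "q \<in> Q" "q \<subseteq> y" and yU: "y \<subseteq> U \<times> U"
    unfolding mem_up_full_proper by blast
  have "Domain q \<subseteq> Domain x"
    using x q(1) assms(1) unfolding mem_up_full_proper by (metis Domain_mono)
  moreover have "Range q \<subseteq> Range z"
    using z q(1) assms(2) unfolding mem_up_full_proper by (metis Range_mono)
  ultimately have "q \<subseteq> Id_on (Domain x) O y O Id_on (Range z)"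
    using q(2) by (auto simp: relcomp_unfold Id_on_iff)
  with q(1) yU show "Id_on (Domain x) O y O Id_on (Range z) \<in> up (full_proper U) Q"
    unfolding mem_up_full_proper by blast
qed

lemma cmp_gamma_closed:
  "GammaD_closed (full_proper U) (cmp_gamma (full_proper U) X Y)"
  unfolding cmp_gamma_def by (rule full_proper_GammaD_least(1)[OF up_set_up_full_proper])

lemma cmp_gamma_I:
  assumes "x \<in> X" "y \<in> Y" "x O y \<subseteq> U \<times> U"
  shows "x O y \<in> cmp_gamma (full_proper U) X Y"
proof -
  have "x O y \<in> up (full_proper U) {cmp (full_proper U) c d | c d. c \<in> X \<and> d \<in> Y}"
    using assms unfolding mem_up_full_proper by (auto simp: full_proper_def)
  then show ?thesis
    unfolding cmp_gamma_def using full_proper_GammaD_least(2)[OF up_set_up_full_proper] by blast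
qed

lemma cmp_gamma_least:
  assumes "GammaD_closed (full_proper U) Z"
    and "\<And>x y. x \<in> X \<Longrightarrow> y \<in> Y \<Longrightarrow> \<exists>s\<in>Z. s \<subseteq> x O y"
  shows "cmp_gamma (full_proper U) X Y \<subseteq> Z"
  unfolding cmp_gamma_def
proof (rule full_proper_GammaD_least(3)[OF up_set_up_full_proper assms(1)], rule subsetI)
  fix p assume "p \<in> up (full_proper U) {cmp (full_proper U) c d | c d. c \<in> X \<and> d \<in> Y}"
  then obtain x y where p: "p \<subseteq> U \<times> U" "x \<in> X" "y \<in> Y" "x O y \<subseteq> p"
    unfolding mem_up_full_proper by (auto simp: full_proper_def)
  from assms(2)[OF p(2,3)] obtain s where s: "s \<in> Z" "s \<subseteq> x O y" by blast
  moreover have "up_set (full_proper U) Z" using assms(1) unfolding full_proper_closed_iff by blast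
  ultimately show "p \<in> Z" using p(1,4) by (auto simp: up_set_def full_proper_def)
qed

theorem mainTheorem5:
  fixes U :: "'u set"
  assumes "card U = 5"
  shows "\<exists>A \<in> completion (full_proper U). \<exists>B \<in> completion (full_proper U).
         \<exists>C \<in> completion (full_proper U).
           le_gamma A (id_gamma (full_proper U)) \<and>
           cmp_gamma (full_proper U) (cmp_gamma (full_proper U) A B) C
             \<noteq> cmp_gamma (full_proper U) A (cmp_gamma (full_proper U) B C)"
proof -
  obtain a b c d e where U: "U = {a, b, c, d, e}" and dist: "distinct [a, b, c, d, e]"
  proof -
    have "finite U" using assms card.infinite by fastforce
    then obtain xs where xs: "set xs = U" "distinct xs" using finite_distinct_list by blast
    then have "length xs = 5" using assms distinct_card by metis
    then obtain a b c d e where "xs = [a, b, c, d, e]"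
      by (auto simp: numeral_eq_Suc length_Suc_conv)
    with xs that show thesis by auto
  qed
  let ?P = "full_proper U"
  define b1 where "b1 = {(a, c), (b, d)}"
  define b2 where "b2 = {(a, d), (b, c)}"
  define A where "A = up ?P {{(a, a)}}"
  define B where "B = up ?P {b1, b2}"
  define C where "C = up ?P {{(c, e), (d, e)}}"
  have A: "GammaD_closed ?P A"
    unfolding A_def by (rule GammaD_closed_up_uniform[where D = "{a}" and R = "{a}"]) auto
  have B: "GammaD_closed ?P B"
    unfolding B_def b1_def b2_def
    by (rule GammaD_closed_up_uniform[where D = "{a, b}" and R = "{c, d}"]) auto
  have C: "GammaD_closed ?P C"
    unfolding C_def by (rule GammaD_closed_up_uniform[where D = "{c, d}" and R = "{e}"]) auto
  have "le_gamma A (id_gamma ?P)"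
    unfolding le_gamma_def id_gamma_def A_def
    by (auto simp: mem_up_full_proper U) (auto simp: full_proper_def)
  moreover have "{} \<in> cmp_gamma ?P (cmp_gamma ?P A B) C"
  proof -
    have aA: "{(a, a)} \<in> A" unfolding A_def mem_up_full_proper U by simp
    have bB: "b1 \<in> B" "b2 \<in> B"
      unfolding B_def mem_up_full_proper U b1_def b2_def by auto
    have r: "{(a, a)} O b1 = {(a, c)}" "{(a, a)} O b2 = {(a, d)}"
      using dist unfolding b1_def b2_def by auto
    have ac: "{(a, c)} \<in> cmp_gamma ?P A B"
      using cmp_gamma_I[OF aA bB(1), of U] unfolding r U by simp
    have ad: "{(a, d)} \<in> cmp_gamma ?P A B"
      using cmp_gamma_I[OF aA bB(2), of U] unfolding r U by simp
    have "Id_on (Domain {(a, c)}) O {(a, c)} O Id_on (Range {(a, d)}) \<in> cmp_gamma ?P A B"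
      using cmp_gamma_closed[of U A B] ac ad unfolding full_proper_closed_iff by blast
    moreover have "Id_on (Domain {(a, c)}) O {(a, c)} O Id_on (Range {(a, d)}) = {}"
      using dist by auto
    ultimately have "{} \<in> cmp_gamma ?P A B" by simp
    moreover have "{(c, e), (d, e)} \<in> C" unfolding C_def mem_up_full_proper U by simp
    ultimately show ?thesis using cmp_gamma_I[of "{}" "cmp_gamma ?P A B" _ C U] by simp
  qed
  moreover have "{} \<notin> cmp_gamma ?P A (cmp_gamma ?P B C)"
  proof -
    \<comment> \<open>a closed up-set without the empty relation that bounds the composite from outside\<close>
    define Z where "Z = up ?P {{(a, e)}}"
    have Z: "GammaD_closed ?P Z"
      unfolding Z_def by (rule GammaD_closed_up_uniform[where D = "{a}" and R = "{e}"]) auto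
    have ae: "{(a, e)} \<in> Z" unfolding Z_def mem_up_full_proper U by simp
    have BC: "cmp_gamma ?P B C \<subseteq> Z"
    proof (rule cmp_gamma_least[OF Z])
      fix x y assume "x \<in> B" "y \<in> C"
      then have "(a, e) \<in> x O y"
        unfolding B_def C_def mem_up_full_proper b1_def b2_def by auto
      then show "\<exists>s\<in>Z. s \<subseteq> x O y" by (intro bexI[OF _ ae]) simp
    qed
    have "cmp_gamma ?P A (cmp_gamma ?P B C) \<subseteq> Z"
    proof (rule cmp_gamma_least[OF Z])
      fix x y assume "x \<in> A" "y \<in> cmp_gamma ?P B C"
      with BC have "x \<in> A" "y \<in> Z" by auto
      then have "(a, e) \<in> x O y"
        unfolding A_def Z_def mem_up_full_proper by auto
      then show "\<exists>s\<in>Z. s \<subseteq> x O y" by (intro bexI[OF _ ae]) simp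
    qed
    moreover have "{} \<notin> Z" unfolding Z_def mem_up_full_proper by simp
    ultimately show ?thesis by blast
  qed
  ultimately have "le_gamma A (id_gamma ?P) \<and>
      cmp_gamma ?P (cmp_gamma ?P A B) C \<noteq> cmp_gamma ?P A (cmp_gamma ?P B C)"
    by metis
  moreover have "A \<in> completion ?P" "B \<in> completion ?P" "C \<in> completion ?P"
    using A B C unfolding completion_def by simp_all
  ultimately show ?thesis by (intro bexI)
qed

end
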